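(* If $n$ is sufficiently large, then $p_n > 0.7\, n$.
   Context: For $n \geq 1$, $Q_n$ is the $n\times n$ chessboard in $[-1,1]^2$ whose cells are the closed squares $c_{ij} = \left[-1+(i-1)\frac 2n, -1+i\frac 2n\right] \times \left[-1+(j-1)\frac 2n, -1+j\frac 2n\right]$ for $i,j \in \{1,\dots,n\}$. A line $\ell$ pierces a cell $c_{ij}$ if $\ell \cap \operatorname{int} c_{ij} \neq \emptyset$. $p_n$ denotes the minimum number of lines needed to pierce every cell of $Q_n$. *)

theory Defs
  imports "HOL-Analysis.Analysis"
begin

definition cell :: "nat \<Rightarrow> nat \<Rightarrow> nat \<Rightarrow> (real \<times> real) set" where
  "cell n i j =
     {-1 + (real i - 1) * (2 / real n) .. -1 + real i * (2 / real n)} \<times>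
     {-1 + (real j - 1) * (2 / real n) .. -1 + real j * (2 / real n)}"

definition is_line :: "(real \<times> real) set \<Rightarrow> bool" where
  "is_line L \<longleftrightarrow> affine L \<and> aff_dim L = 1"

definition pierces :: "(real \<times> real) set \<Rightarrow> (real \<times> real) set \<Rightarrow> bool" where
  "pierces L c \<longleftrightarrow> L \<inter> interior c \<noteq> {}"

definition pierces_board :: "nat \<Rightarrow> (real \<times> real) set set \<Rightarrow> bool" where
  "pierces_board n F \<longleftrightarrow>
     (\<forall>L\<in>F. is_line L) \<and> (\<forall>i\<in>{1..n}. \<forall>j\<in>{1..n}. \<exists>L\<in>F. pierces L (cell n i j))"

definition piercing_number :: "nat \<Rightarrow> nat" where
  "piercing_number n = (LEAST k. \<exists>F. finite F \<and> card F = k \<and> pierces_board n F)"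

text \<open>The minimum is attained: one vertical line through the middle of each column pierces
  every cell.\<close>

lemma piercing_number_attained:
  "\<exists>F. finite F \<and> card F = piercing_number n \<and> pierces_board n F"
proof -
  define m where "m i = -1 + (real i - 1 / 2) * (2 / real n)" for i
  define V where "V i = {m i} \<times> (UNIV :: real set)" for i
  have line: "is_line (V i)" for i
  proof -
    have eq: "V i = {x. (1, 0) \<bullet> x = m i}"
      by (auto simp: V_def)
    have "(1, 0) \<noteq> (0 :: real \<times> real)"
      by (simp add: zero_prod_def)
    then have "aff_dim {x :: real \<times> real. (1, 0) \<bullet> x = m i} = 1"
      by (simp add: aff_dim_hyperplane)
    then show ?thesis
      unfolding is_line_def eq by (simp add: affine_hyperplane)
  qed
  have pierce: "pierces (V i) (cell n i j)" if "i \<in> {1..n}" "j \<in> {1..n}" for i j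
  proof -
    have "(m i, m j) \<in> V i \<inter> interior (cell n i j)"
      using that by (auto simp: V_def m_def cell_def interior_Times divide_strict_right_mono)
    then show ?thesis
      unfolding pierces_def by blast
  qed
  have "pierces_board n (V ` {1..n})"
    using line pierce unfolding pierces_board_def by blast
  then have "\<exists>k F. finite F \<and> card F = k \<and> pierces_board n F"
    by blast
  then show ?thesis
    unfolding piercing_number_def by (rule LeastI_ex)
qed

end

theory Submission
  imports Defs
begin

text \<open>By Archimedes' theorem, the density \<open>1 / sqrt (1 - |x|^2)\<close> on the unit disc has integral
  \<open>pi\<close> along every chord and total mass \<open>2 * pi\<close>. Up to lower-order terms a line with unit
  direction \<open>(v, u)\<close> pierces \<open>n / 2 * (|v| + |u|)\<close> cells per unit length, so if every cell carries
  the density at its centre, a line collects at most \<open>n / 2 * sqrt 2 * pi\<close>, whereas all cells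
  together carry \<open>(n / 2)^2 * 2 * pi\<close>. Hence about \<open>n / sqrt 2 > 0.7 * n\<close> lines are needed. The
  singularity at the rim is removed by using \<open>1 / sqrt (1 + 2 * e - |x|^2)\<close> on the unit disc.
  The cells pierced by a line are counted by their entry points, which form two arithmetic
  progressions on the line, one for each family of grid lines; sums over them are compared with
  increments of \<open>arcsin\<close>, the antiderivative of the density along a chord.\<close>

section \<open>Riemann sums of the chord density\<close>

text \<open>Mean value theorem: the derivative 1 / sqrt (L^2 - x^2) increases on [0, L), so its
  endpoint values bound the difference quotient. The first bound serves the upper estimate for a
  line, the second the lower estimate for the total weight.\<close>

lemma arcsin_increment:
  fixes a b L :: real
  assumes "0 \<le> a" "a \<le> b" "b < L"
  shows "(b - a) / sqrt (L\<^sup>2 - a\<^sup>2) \<le> arcsin (b / L) - arcsin (a / L)"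
    and "arcsin (b / L) - arcsin (a / L) \<le> (b - a) / sqrt (L\<^sup>2 - b\<^sup>2)"
proof -
  have "(b - a) / sqrt (L\<^sup>2 - a\<^sup>2) \<le> arcsin (b / L) - arcsin (a / L) \<and>
      arcsin (b / L) - arcsin (a / L) \<le> (b - a) / sqrt (L\<^sup>2 - b\<^sup>2)"
  proof (cases "a = b")
    case False
    then have "a < b" using assms by simp
    have L: "L > 0" using assms by simp
    have der: "((\<lambda>x. arcsin (x / L)) has_real_derivative 1 / sqrt (L\<^sup>2 - x\<^sup>2)) (at x)"
      if "a \<le> x" "x \<le> b" for x
    proof -
      have "sqrt (1 - (x / L)\<^sup>2) * L = sqrt (L\<^sup>2 - x\<^sup>2)"
      proof -
        have "sqrt (L\<^sup>2 - x\<^sup>2) = sqrt ((1 - (x / L)\<^sup>2) * L\<^sup>2)"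
          using L by (simp add: field_simps)
        then show ?thesis using L by (simp add: real_sqrt_mult)
      qed
      then have "inverse (sqrt (1 - (x / L)\<^sup>2)) * (1 / L) = 1 / sqrt (L\<^sup>2 - x\<^sup>2)"
        by (metis divide_inverse inverse_mult_distrib mult_1)
      moreover have "((\<lambda>x. arcsin (x / L)) has_real_derivative
          inverse (sqrt (1 - (x / L)\<^sup>2)) * (1 / L)) (at x)"
        using that assms L
        by (intro DERIV_chain2[OF DERIV_arcsin]) (auto intro!: derivative_eq_intros simp: field_simps)
      ultimately show ?thesis by simp
    qed
    obtain z where z: "a < z" "z < b"
      "arcsin (b / L) - arcsin (a / L) = (b - a) * (1 / sqrt (L\<^sup>2 - z\<^sup>2))"
      using MVT2[OF \<open>a < b\<close> der] by auto
    have sq: "a\<^sup>2 \<le> z\<^sup>2" "z\<^sup>2 \<le> b\<^sup>2" "b\<^sup>2 < L\<^sup>2"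
      using assms z by (auto intro!: power_mono power_strict_mono)
    then have "a\<^sup>2 < L\<^sup>2" "z\<^sup>2 < L\<^sup>2" by linarith+
    then show ?thesis
      unfolding z(3) using sq assms by (auto intro!: divide_left_mono mult_pos_pos)
  qed simp
  then show "(b - a) / sqrt (L\<^sup>2 - a\<^sup>2) \<le> arcsin (b / L) - arcsin (a / L)"
    and "arcsin (b / L) - arcsin (a / L) \<le> (b - a) / sqrt (L\<^sup>2 - b\<^sup>2)" by auto
qed

text \<open>A lower Riemann sum: the intervals [t, t + \<tau>] do not overlap and lie in [0, b], and
  the density increases there, so each term is at most an increment of \<open>arcsin\<close>. The
  induction removes the largest point \<open>c\<close>, which becomes the new bound for the
  rest.\<close>

lemma separated_sum_le_arcsin:
  fixes T :: "real set"
  assumes "finite T" "\<And>x y. x \<in> T \<Longrightarrow> y \<in> T \<Longrightarrow> x \<noteq> y \<Longrightarrow> \<tau> \<le> \<bar>x - y\<bar>"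
    and "\<And>t. t \<in> T \<Longrightarrow> 0 \<le> t \<and> t + \<tau> \<le> b" "0 \<le> b" "b < L" "0 \<le> \<tau>"
  shows "\<tau> * (\<Sum>t\<in>T. 1 / sqrt (L\<^sup>2 - t\<^sup>2)) \<le> arcsin (b / L)"
  using assms
proof (induction T arbitrary: b rule: finite_linorder_max_induct)
  case empty
  then show ?case by (auto intro!: arcsin_nonneg)
next
  case (insert c A)
  have c: "0 \<le> c" "c + \<tau> \<le> b" using insert.prems(2)[of c] by auto
  have "\<tau> * (\<Sum>t\<in>A. 1 / sqrt (L\<^sup>2 - t\<^sup>2)) \<le> arcsin (c / L)"
  proof (rule insert.IH)
    fix t assume t: "t \<in> A"
    then have "\<tau> \<le> \<bar>c - t\<bar>" "t < c" using insert.prems(1)[of c t] insert.hyps by auto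
    then show "0 \<le> t \<and> t + \<tau> \<le> c" using insert.prems(2)[of t] t by auto
  next
    show "c < L"
      using c insert.prems(4,5) by linarith
  qed (use insert.prems c in auto)
  moreover have "\<tau> / sqrt (L\<^sup>2 - c\<^sup>2) \<le> arcsin ((c + \<tau>) / L) - arcsin (c / L)"
    using arcsin_increment(1)[of c "c + \<tau>" L] c insert.prems by simp
  moreover have "arcsin ((c + \<tau>) / L) \<le> arcsin (b / L)"
  proof (rule arcsin_le_arcsin)
    have "0 \<le> (c + \<tau>) / L" using c insert.prems(3-5) by simp
    then show "- 1 \<le> (c + \<tau>) / L" by linarith
    show "(c + \<tau>) / L \<le> b / L" using c insert.prems(3,4) by (intro divide_right_mono) auto
    show "b / L \<le> 1" using insert.prems(3,4) by simp
  qed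
  moreover have "c \<notin> A" using insert.hyps by auto
  ultimately show ?case
    using insert.hyps by (simp add: algebra_simps)
qed

text \<open>The interval to the right of the largest point may reach the singularity, so that term
  is bounded by \<open>\<tau> / sqrt e\<close> alone. The intervals of all other points end at or
  before it.\<close>

lemma separated_sum_nonneg_le:
  fixes T :: "real set"
  assumes "finite T" "\<And>x y. x \<in> T \<Longrightarrow> y \<in> T \<Longrightarrow> x \<noteq> y \<Longrightarrow> \<tau> \<le> \<bar>x - y\<bar>"
    and T: "\<And>t. t \<in> T \<Longrightarrow> 0 \<le> t \<and> e \<le> D - t\<^sup>2" and "0 \<le> \<tau>" "0 < e"
  shows "\<tau> * (\<Sum>t\<in>T. 1 / sqrt (D - t\<^sup>2)) \<le> pi / 2 + \<tau> / sqrt e"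
proof (cases "T = {}")
  case True
  then show ?thesis using assms by simp
next
  case False
  define b where "b = Max T"
  have b: "b \<in> T" using False assms(1) by (simp add: b_def)
  define L where "L = sqrt D"
  have "D > 0" using T[OF b] \<open>0 < e\<close> by (smt (verit) zero_le_power2)
  then have D: "D = L\<^sup>2" by (simp add: L_def)
  have "b < L" unfolding L_def using T[OF b] \<open>0 < e\<close> by (intro real_less_rsqrt) auto
  have "\<tau> * (\<Sum>t\<in>T - {b}. 1 / sqrt (L\<^sup>2 - t\<^sup>2)) \<le> arcsin (b / L)"
  proof (rule separated_sum_le_arcsin)
    fix t assume t: "t \<in> T - {b}"
    then have "t \<le> b" using assms(1) by (simp add: b_def)
    then show "0 \<le> t \<and> t + \<tau> \<le> b" using T[of t] t assms(2)[of t b] b by auto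
  qed (use assms \<open>b < L\<close> T[OF b] in auto)
  also have "\<dots> \<le> pi / 2"
    using T[OF b] \<open>b < L\<close> by (intro arcsin_ubound) (auto simp: field_simps)
  finally have "\<tau> * (\<Sum>t\<in>T - {b}. 1 / sqrt (L\<^sup>2 - t\<^sup>2)) \<le> pi / 2" .
  moreover have "\<tau> / sqrt (L\<^sup>2 - b\<^sup>2) \<le> \<tau> / sqrt e"
    using T[OF b] D assms by (intro divide_left_mono) (auto intro!: mult_pos_pos)
  moreover have "(\<Sum>t\<in>T. 1 / sqrt (L\<^sup>2 - t\<^sup>2)) =
      1 / sqrt (L\<^sup>2 - b\<^sup>2) + (\<Sum>t\<in>T - {b}. 1 / sqrt (L\<^sup>2 - t\<^sup>2))"
    using sum.remove[OF assms(1) b] .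
  ultimately show ?thesis unfolding D by (simp add: algebra_simps)
qed

lemma separated_sum_le:
  fixes T :: "real set"
  assumes "finite T" "\<And>x y. x \<in> T \<Longrightarrow> y \<in> T \<Longrightarrow> x \<noteq> y \<Longrightarrow> \<tau> \<le> \<bar>x - y\<bar>"
    and T: "\<And>t. t \<in> T \<Longrightarrow> e \<le> D - t\<^sup>2" and "0 \<le> \<tau>" "0 < e"
  shows "\<tau> * (\<Sum>t\<in>T. 1 / sqrt (D - t\<^sup>2)) \<le> pi + 2 * (\<tau> / sqrt e)"
proof -
  define P where "P = {t\<in>T. 0 \<le> t}"
  \<comment> \<open>The density is even, so the negative points are reflected and each half
    contributes at most pi / 2 plus one exceptional term.\<close>
  define N where "N = uminus ` (T - P)"
  have "\<tau> * (\<Sum>t\<in>P. 1 / sqrt (D - t\<^sup>2)) \<le> pi / 2 + \<tau> / sqrt e"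
    by (rule separated_sum_nonneg_le) (use assms in \<open>auto simp: P_def\<close>)
  moreover have "\<tau> * (\<Sum>t\<in>N. 1 / sqrt (D - t\<^sup>2)) \<le> pi / 2 + \<tau> / sqrt e"
  proof (rule separated_sum_nonneg_le)
    fix x y assume "x \<in> N" "y \<in> N" "x \<noteq> y"
    then show "\<tau> \<le> \<bar>x - y\<bar>" using assms(2)[of "-y" "-x"] by (auto simp: N_def)
  qed (use assms in \<open>auto simp: P_def N_def\<close>)
  moreover have "(\<Sum>t\<in>N. 1 / sqrt (D - t\<^sup>2)) = (\<Sum>t\<in>T - P. 1 / sqrt (D - t\<^sup>2))"
    unfolding N_def by (subst sum.reindex) auto
  moreover have "(\<Sum>t\<in>T. 1 / sqrt (D - t\<^sup>2)) =
      (\<Sum>t\<in>T - P. 1 / sqrt (D - t\<^sup>2)) + (\<Sum>t\<in>P. 1 / sqrt (D - t\<^sup>2))"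
    using assms(1) by (intro sum.subset_diff) (auto simp: P_def)
  ultimately show ?thesis by (simp add: algebra_simps)
qed

section \<open>Cell centres, weights and entry times\<close>

definition center :: "nat \<Rightarrow> nat \<Rightarrow> real" where
  "center n i = (2 * real i - 1 - real n) / real n"

definition disc_cells :: "nat \<Rightarrow> (nat \<times> nat) set" where
  "disc_cells n = {(i, j). i \<in> {1..n} \<and> j \<in> {1..n} \<and> (center n i)\<^sup>2 + (center n j)\<^sup>2 \<le> 1}"

definition weight :: "real \<Rightarrow> nat \<Rightarrow> nat \<times> nat \<Rightarrow> real" where
  "weight e n = (\<lambda>(i, j). 1 / sqrt (1 + 2 * e - (center n i)\<^sup>2 - (center n j)\<^sup>2))"

lemma finite_disc_cells: "finite (disc_cells n)"
  by (rule finite_subset[of _ "{1..n} \<times> {1..n}"]) (auto simp: disc_cells_def)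

lemma center_diff: "n > 0 \<Longrightarrow> center n i - center n j = (real i - real j) * (2 / real n)"
  by (simp add: center_def field_simps)

text \<open>Unlike \<open>sgn\<close>, this is a unit also at \<open>0\<close>, which lets \<open>enters\<close> below cover lines parallel
  to an axis.\<close>

definition unit_sign :: "real \<Rightarrow> real" where
  "unit_sign v = (if v \<ge> 0 then 1 else - 1)"

lemma unit_sign_mult: "unit_sign v * v = \<bar>v\<bar>" by (simp add: unit_sign_def)

text \<open>With \<open>p + t * v\<close> a coordinate of a moving point, the time at which it enters the \<open>i\<close>-th slab
  (junk for \<open>v = 0\<close>).\<close>

definition entry :: "nat \<Rightarrow> real \<Rightarrow> real \<Rightarrow> nat \<Rightarrow> real" where
  "entry n p v i = (center n i - unit_sign v / real n - p) / v"

text \<open>The point enters the cell through a side orthogonal to its first coordinate axis. The interval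
  is half-open in the direction of motion, so that the entry time determines the cell.\<close>

definition enters :: "nat \<Rightarrow> real \<Rightarrow> real \<Rightarrow> real \<Rightarrow> real \<Rightarrow> nat \<Rightarrow> nat \<Rightarrow> bool" where
  "enters n p v q u i j \<longleftrightarrow> v \<noteq> 0 \<and>
     - 1 / real n \<le> unit_sign u * (q + entry n p v i * u - center n j) \<and>
     unit_sign u * (q + entry n p v i * u - center n j) < 1 / real n"

lemma unit_sign_shift:
  "unit_sign u * (q + s * u - c) = unit_sign u * (q + t * u - c) - \<bar>u\<bar> * (t - s)"
  unfolding unit_sign_mult[symmetric] by (simp add: algebra_simps)

lemma abs_unit_sign_mult: "\<bar>unit_sign u * x\<bar> = \<bar>x\<bar>"
  by (simp add: unit_sign_def)

lemma entry_time:
  assumes "v \<noteq> 0"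
  shows "\<bar>v\<bar> * (t - entry n p v i) = unit_sign v * (p + t * v - center n i) + 1 / real n"
proof -
  have "p + entry n p v i * v - center n i = - unit_sign v / real n"
    using assms by (simp add: entry_def)
  then have "unit_sign v * (p + entry n p v i * v - center n i) = - 1 / real n"
    by (simp add: unit_sign_def)
  then show ?thesis
    using unit_sign_shift[of v p "entry n p v i" "center n i" t] by simp
qed

text \<open>A moving point enters a cell when it enters the later of the two slabs. The last
  hypothesis makes this slab \<open>i\<close>; between that time and \<open>t\<close> the other
  coordinate cannot have left slab \<open>j\<close>, since it was inside at both ends.\<close>

lemma entersI:
  assumes "v \<noteq> 0" "\<bar>p + t * v - center n i\<bar> < 1 / real n" "\<bar>q + t * u - center n j\<bar> < 1 / real n"
    and "u \<noteq> 0 \<Longrightarrow> entry n q u j \<le> entry n p v i"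
  shows "enters n p v q u i j"
proof -
  have x: "\<bar>unit_sign v * (p + t * v - center n i)\<bar> < 1 / real n"
    and y: "\<bar>unit_sign u * (q + t * u - center n j)\<bar> < 1 / real n"
    using assms by (simp_all only: abs_unit_sign_mult)
  have "0 < \<bar>v\<bar> * (t - entry n p v i)"
    unfolding entry_time[OF assms(1)] using x by linarith
  then have "0 \<le> \<bar>u\<bar> * (t - entry n p v i)"
    by (simp add: zero_less_mult_iff)
  moreover have "\<bar>u\<bar> * (t - entry n p v i) \<le> unit_sign u * (q + t * u - center n j) + 1 / real n"
  \<comment> \<open>For \<open>u = 0\<close> the second coordinate is constant and has no entry
    time.\<close>
  proof (cases "u = 0")
    case True
    then show ?thesis using y by (auto simp: abs_less_iff)
  next
    case False
    have "\<bar>u\<bar> * (t - entry n p v i) \<le> \<bar>u\<bar> * (t - entry n q u j)"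
      using assms(4) False by (intro mult_left_mono) auto
    then show ?thesis using entry_time[OF False] by simp
  qed
  ultimately show ?thesis
    unfolding enters_def unit_sign_shift[of u q "entry n p v i" _ t] using assms(1) y by linarith
qed

lemma pierced_imp_enters:
  assumes "\<bar>p + t * v - center n i\<bar> < 1 / real n" "\<bar>q + t * u - center n j\<bar> < 1 / real n"
    and "v \<noteq> 0 \<or> u \<noteq> 0"
  shows "enters n p v q u i j \<or> enters n q u p v j i"
proof (cases "v \<noteq> 0 \<and> (u \<noteq> 0 \<longrightarrow> entry n q u j \<le> entry n p v i)")
  case True
  then show ?thesis using entersI assms by blast
next
  case False
  then have "u \<noteq> 0" "v \<noteq> 0 \<Longrightarrow> entry n p v i \<le> entry n q u j" using assms(3) by auto
  then show ?thesis using entersI assms by blast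
qed

section \<open>The weight collected by one line\<close>

text \<open>Crossings of successive parallel grid lines are \<tau> = 2 / (n |v|) apart in time, so
  \<open>separated_sum_le\<close> applies to the entry times; dividing its bound by \<tau> gives the
  claim.\<close>

lemma entering_sum_le:
  assumes n: "n > 0" and "finite S" "v \<noteq> 0" "e > 0"
    and S: "\<And>i j. (i, j) \<in> S \<Longrightarrow> enters n p v q u i j"
    and D: "\<And>i j. (i, j) \<in> S \<Longrightarrow> e \<le> D - (entry n p v i)\<^sup>2"
    and w: "\<And>i j. (i, j) \<in> S \<Longrightarrow> w (i, j) \<le> 1 / sqrt (D - (entry n p v i)\<^sup>2)"
  shows "sum w S \<le> real n / 2 * \<bar>v\<bar> * pi + 2 / sqrt e"
proof -
  define f where "f = (\<lambda>ij :: nat \<times> nat. entry n p v (fst ij))"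
  define \<tau> where "\<tau> = 2 / (real n * \<bar>v\<bar>)"
  have \<tau>: "\<tau> > 0" using n \<open>v \<noteq> 0\<close> by (simp add: \<tau>_def)
  have dist: "\<bar>entry n p v i - entry n p v k\<bar> = \<bar>real i - real k\<bar> * \<tau>" for i k
  proof -
    have "entry n p v i - entry n p v k = (center n i - center n k) / v"
      by (simp add: entry_def diff_divide_distrib[symmetric])
    also have "\<dots> = (real i - real k) * (2 / (real n * v))"
      using n by (simp only: center_diff) simp
    finally show ?thesis by (simp only: abs_mult \<tau>_def) (simp add: abs_mult)
  qed
  have inj: "inj_on f S"
  proof (rule inj_onI)
    fix x y assume x: "x \<in> S" and y: "y \<in> S" and eq: "f x = f y"
    obtain i j k l where xy: "x = (i, j)" "y = (k, l)" by (metis surj_pair)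
    have "i = k" using dist[of i k] eq \<tau> by (simp add: xy f_def)
    \<comment> \<open>The offsets of one entry point from two centres both lie in [-1/n, 1/n).
      Half-openness makes their difference strictly less than the spacing 2/n of the
      centres.\<close>
    then have "\<bar>unit_sign u * (center n l - center n j)\<bar> < 2 / real n"
      using S[of i j] S[of k l] x y unfolding xy enters_def
      by (auto simp: algebra_simps abs_less_iff)
    then have "\<bar>real l - real j\<bar> * (2 / real n) < 1 * (2 / real n)"
      unfolding abs_unit_sign_mult center_diff[OF n] by (simp only: abs_mult) simp
    then have "\<bar>real l - real j\<bar> < 1"
      using n by (subst (asm) mult_less_cancel_right_pos) auto
    then show "x = y" using \<open>i = k\<close> xy by auto
  qed
  have "\<tau> * (\<Sum>t\<in>f ` S. 1 / sqrt (D - t\<^sup>2)) \<le> pi + 2 * (\<tau> / sqrt e)"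
  proof (rule separated_sum_le)
    fix x y assume "x \<in> f ` S" "y \<in> f ` S" "x \<noteq> y"
    then obtain i k where ik: "x = entry n p v i" "y = entry n p v k" by (auto simp: f_def)
    with \<open>x \<noteq> y\<close> have "i \<noteq> k" by auto
    then have "1 \<le> \<bar>real i - real k\<bar>" by auto
    then show "\<tau> \<le> \<bar>x - y\<bar>" unfolding ik dist using \<tau> by simp
  qed (use assms \<tau> D in \<open>auto simp: f_def\<close>)
  then have "(\<Sum>t\<in>f ` S. 1 / sqrt (D - t\<^sup>2)) \<le> (pi + 2 * (\<tau> / sqrt e)) / \<tau>"
    using \<tau> by (simp add: field_simps)
  also have "\<dots> = real n / 2 * \<bar>v\<bar> * pi + 2 / sqrt e"
    using n \<open>v \<noteq> 0\<close> \<open>e > 0\<close> by (simp add: \<tau>_def field_simps)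
  finally have "(\<Sum>t\<in>f ` S. 1 / sqrt (D - t\<^sup>2)) \<le> real n / 2 * \<bar>v\<bar> * pi + 2 / sqrt e" .
  moreover have "sum w S \<le> (\<Sum>x\<in>S. 1 / sqrt (D - (f x)\<^sup>2))"
    using w by (intro sum_mono) (auto simp: f_def)
  ultimately show ?thesis by (simp add: sum.reindex[OF inj])
qed

text \<open>Time is measured from the foot (p, q) of the perpendicular from the origin, the midpoint
  of any chord of the disc. Hence the squared distance from the origin at time t is p^2 + q^2 + t^2.
  The direction is the unit normal turned by a right angle.\<close>

lemma is_line_unit_speed:
  assumes "is_line L"
  obtains p q v u where "v\<^sup>2 + u\<^sup>2 = 1" "p * v + q * u = 0"
    "\<And>x. x \<in> L \<Longrightarrow> \<exists>t. x = (p + t * v, q + t * u)"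
proof -
  have "aff_dim L = int (DIM(real \<times> real) - 1)" "affine hull L = L"
    using assms by (auto simp: is_line_def affine_hull_eq)
  then obtain a b where "a \<noteq> 0" and L: "L = {x. a \<bullet> x = b}"
    unfolding aff_dim_eq_hyperplane by metis
  obtain a1 a2 where a: "a = (a1, a2)" by (cases a)
  define r where "r = sqrt (a1\<^sup>2 + a2\<^sup>2)"
  have "a1\<^sup>2 + a2\<^sup>2 > 0" using \<open>a \<noteq> 0\<close> a by (simp add: sum_power2_gt_zero_iff zero_prod_def)
  then have r: "r > 0" "r\<^sup>2 = a1\<^sup>2 + a2\<^sup>2" by (auto simp: r_def)
  show ?thesis
  proof
    have "(- a2 / r)\<^sup>2 + (a1 / r)\<^sup>2 = (a1\<^sup>2 + a2\<^sup>2) / r\<^sup>2"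
      by (simp add: power_divide add_divide_distrib)
    then show "(- a2 / r)\<^sup>2 + (a1 / r)\<^sup>2 = 1"
      using r(1) unfolding r(2)[symmetric] by simp
    show "(b * a1 / r\<^sup>2) * (- a2 / r) + (b * a2 / r\<^sup>2) * (a1 / r) = 0"
      by simp
    fix x assume "x \<in> L"
    obtain x1 x2 where x: "x = (x1, x2)" by (cases x)
    have b: "b = a1 * x1 + a2 * x2" using \<open>x \<in> L\<close> L a x by simp
    define t where "t = (a1 * x2 - a2 * x1) / r"
    have "b * a1 / r\<^sup>2 + t * (- a2 / r) = (b * a1 - (a1 * x2 - a2 * x1) * a2) / r\<^sup>2"
      by (simp add: t_def power2_eq_square flip: diff_divide_distrib)
    also have "\<dots> = x1 * r\<^sup>2 / r\<^sup>2" unfolding b r(2) by (simp add: algebra_simps power2_eq_square)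
    finally have 1: "b * a1 / r\<^sup>2 + t * (- a2 / r) = x1" using r(1) by simp
    have "b * a2 / r\<^sup>2 + t * (a1 / r) = (b * a2 + (a1 * x2 - a2 * x1) * a1) / r\<^sup>2"
      by (simp add: t_def power2_eq_square flip: add_divide_distrib)
    also have "\<dots> = x2 * r\<^sup>2 / r\<^sup>2" unfolding b r(2) by (simp add: algebra_simps power2_eq_square)
    finally have "b * a2 / r\<^sup>2 + t * (a1 / r) = x2" using r(1) by simp
    with 1 show "\<exists>t. x = (b * a1 / r\<^sup>2 + t * (- a2 / r), b * a2 / r\<^sup>2 + t * (a1 / r))"
      using x by auto
  qed
qed

lemma interior_cell:
  assumes "n > 0"
  shows "interior (cell n i j) =
    {(x, y). \<bar>x - center n i\<bar> < 1 / real n \<and> \<bar>y - center n j\<bar> < 1 / real n}"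
  using assms by (auto simp: cell_def interior_Times center_def abs_less_iff field_simps)

lemma abs_center_le: "i \<in> {1..n} \<Longrightarrow> \<bar>center n i\<bar> \<le> 1"
  by (auto simp: center_def abs_le_iff field_simps)

lemma power2_center_diff_le:
  assumes "\<bar>c\<bar> \<le> 1" "\<bar>x - c\<bar> \<le> d" "d \<le> 1"
  shows "\<bar>x\<^sup>2 - c\<^sup>2\<bar> \<le> 3 * (d::real)"
proof -
  have "\<bar>x\<^sup>2 - c\<^sup>2\<bar> = \<bar>x - c\<bar> * \<bar>x + c\<bar>" by (simp add: power2_eq_square algebra_simps flip: abs_mult)
  \<comment> \<open>The second factor satisfies |x + c| \<le> |x - c| + 2 |c| \<le> 3.\<close>
  also have "\<dots> \<le> d * 3" using assms by (intro mult_mono) auto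
  finally show ?thesis by simp
qed

text \<open>Moving from the centre to the entry point changes each squared coordinate by at most
  3/n. Subtracting 6/n in \<open>D\<close> makes the density at the entry point dominate the weight
  of the cell; the total loss 12/n uses up at most one of the two \<open>e\<close>, and the other
  keeps the root away from 0.\<close>

lemma enters_weight_bounds:
  assumes "n > 0" "12 / real n \<le> e" "e > 0" "(i, j) \<in> disc_cells n \<or> (j, i) \<in> disc_cells n"
    and vu: "v\<^sup>2 + u\<^sup>2 = 1" "p * v + q * u = 0" and ent: "enters n p v q u i j"
  defines "D \<equiv> 1 + 2 * e - 6 / real n - p\<^sup>2 - q\<^sup>2"
  shows "e \<le> D - (entry n p v i)\<^sup>2" "weight e n (i, j) \<le> 1 / sqrt (D - (entry n p v i)\<^sup>2)"
proof -
  define t where "t = entry n p v i"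
  have v: "v \<noteq> 0" using ent by (simp add: enters_def)
  have "p + t * v - center n i = - unit_sign v / real n" using v by (simp add: t_def entry_def)
  then have "\<bar>p + t * v - center n i\<bar> \<le> 1 / real n" by (simp add: unit_sign_def)
  moreover have "\<bar>q + t * u - center n j\<bar> \<le> 1 / real n"
    using ent unfolding enters_def t_def[symmetric] unit_sign_def by (auto split: if_splits)
  moreover have ij: "i \<in> {1..n}" "j \<in> {1..n}" "(center n i)\<^sup>2 + (center n j)\<^sup>2 \<le> 1"
    using assms(4) by (auto simp: disc_cells_def)
  moreover have "1 / real n \<le> 1" using \<open>n > 0\<close> by simp
  ultimately have "\<bar>(p + t * v)\<^sup>2 - (center n i)\<^sup>2\<bar> \<le> 3 * (1 / real n)"
    "\<bar>(q + t * u)\<^sup>2 - (center n j)\<^sup>2\<bar> \<le> 3 * (1 / real n)"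
    by (intro power2_center_diff_le abs_center_le; simp)+
  moreover have "(p + t * v)\<^sup>2 + (q + t * u)\<^sup>2 = p\<^sup>2 + q\<^sup>2 + t\<^sup>2"
  proof -
    have "(p + t * v)\<^sup>2 + (q + t * u)\<^sup>2 = p\<^sup>2 + q\<^sup>2 + t\<^sup>2 * (v\<^sup>2 + u\<^sup>2) + 2 * t * (p * v + q * u)"
      by (simp add: power2_eq_square algebra_simps)
    then show ?thesis using vu by simp
  qed
  ultimately show "e \<le> D - (entry n p v i)\<^sup>2"
    and "weight e n (i, j) \<le> 1 / sqrt (D - (entry n p v i)\<^sup>2)"
    using assms ij(3) unfolding t_def[symmetric] D_def weight_def
    by (auto intro!: divide_left_mono mult_pos_pos)
qed

lemma weight_swap: "weight e n (prod.swap x) = weight e n x"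
  by (cases x) (simp add: weight_def algebra_simps)

lemma line_weight_le:
  assumes "is_line L" and n: "n > 0" "12 / real n \<le> e" "e > 0"
  shows "sum (weight e n) {(i, j) \<in> disc_cells n. pierces L (cell n i j)}
    \<le> real n / 2 * (sqrt 2 * pi) + 4 / sqrt e"
proof -
  obtain p q v u where vu: "v\<^sup>2 + u\<^sup>2 = 1" "p * v + q * u = 0"
    and L: "\<And>x. x \<in> L \<Longrightarrow> \<exists>t. x = (p + t * v, q + t * u)"
    using is_line_unit_speed[OF assms(1)] by metis
  have uv: "u\<^sup>2 + v\<^sup>2 = 1" "q * u + p * v = 0" using vu by auto
  define S where "S = {(i, j) \<in> disc_cells n. pierces L (cell n i j)}"
  define A where "A = {(i, j) \<in> disc_cells n. enters n p v q u i j}"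
  \<comment> \<open>\<open>B\<close> stores cells with their coordinates exchanged, so that
    \<open>entering_sum_le\<close> applies with the axes swapped; \<open>prod.swap\<close> recovers
    the cells.\<close>
  define B where "B = {(i, j). (j, i) \<in> disc_cells n \<and> enters n q u p v i j}"
  have fin: "finite A" "finite B"
    by (rule finite_subset[of _ "{1..n} \<times> {1..n}"]; auto simp: A_def B_def disc_cells_def)+
  have pos: "weight e n x \<ge> 0" if "x \<in> disc_cells n" for x
    using that n by (auto simp: weight_def disc_cells_def)
  have sub: "S \<subseteq> A \<union> prod.swap ` B"
  proof
    fix x assume x: "x \<in> S"
    obtain i j where ij: "x = (i, j)" by (cases x)
    obtain t where "\<bar>p + t * v - center n i\<bar> < 1 / real n" "\<bar>q + t * u - center n j\<bar> < 1 / real n"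
      using x L n unfolding ij S_def pierces_def interior_cell[OF n(1)] by fastforce
    moreover have "v \<noteq> 0 \<or> u \<noteq> 0" using vu by auto
    ultimately have "enters n p v q u i j \<or> enters n q u p v j i"
      using pierced_imp_enters by blast
    then show "x \<in> A \<union> prod.swap ` B" using x by (force simp: ij S_def A_def B_def)
  qed
  have "sum (weight e n) A \<le> real n / 2 * \<bar>v\<bar> * pi + 2 / sqrt e"
  proof (cases "v = 0")
    case True
    then show ?thesis using n by (simp add: A_def enters_def)
  next
    case False
    show ?thesis
      by (rule entering_sum_le[OF n(1) fin(1) False n(3), of p q u "1 + 2 * e - 6 / real n - p\<^sup>2 - q\<^sup>2"])
        (use enters_weight_bounds[OF n _ vu] in \<open>auto simp: A_def\<close>)
  qed
  moreover have "sum (weight e n) B \<le> real n / 2 * \<bar>u\<bar> * pi + 2 / sqrt e"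
  proof (cases "u = 0")
    case True
    then show ?thesis using n by (simp add: B_def enters_def)
  next
    case False
    show ?thesis
      by (rule entering_sum_le[OF n(1) fin(2) False n(3), of q p v "1 + 2 * e - 6 / real n - q\<^sup>2 - p\<^sup>2"])
        (use enters_weight_bounds[OF n _ uv] in \<open>auto simp: B_def\<close>)
  qed
  moreover have "sum (weight e n) S \<le> sum (weight e n) (A \<union> prod.swap ` B)"
    using sub fin pos by (intro sum_mono2) (auto simp: A_def B_def)
  moreover have "\<dots> \<le> sum (weight e n) A + sum (weight e n) (prod.swap ` B)"
  proof -
    have "sum (weight e n) (A \<inter> prod.swap ` B) \<ge> 0"
      using pos by (intro sum_nonneg) (simp add: A_def case_prod_beta)
    then show ?thesis using sum.union_inter[of A "prod.swap ` B" "weight e n"] fin by simp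
  qed
  moreover have "sum (weight e n) (prod.swap ` B) = sum (weight e n) B"
    by (subst sum.reindex) (auto simp: weight_swap)
  moreover have "real n / 2 * \<bar>v\<bar> * pi + real n / 2 * \<bar>u\<bar> * pi \<le> real n / 2 * (sqrt 2 * pi)"
  proof -
    \<comment> \<open>For a unit vector |v| + |u| is largest in the diagonal directions.\<close>
    have "(\<bar>v\<bar> + \<bar>u\<bar>)\<^sup>2 \<le> 2"
      using vu sum_squares_bound[of "\<bar>v\<bar>" "\<bar>u\<bar>"] by (simp add: power2_sum)
    then have "\<bar>v\<bar> + \<bar>u\<bar> \<le> sqrt 2" by (rule real_le_rsqrt)
    then have "(real n / 2 * pi) * (\<bar>v\<bar> + \<bar>u\<bar>) \<le> (real n / 2 * pi) * sqrt 2"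
      by (intro mult_left_mono) auto
    then show ?thesis by (simp add: algebra_simps)
  qed
  ultimately show ?thesis unfolding S_def[symmetric] by (simp add: algebra_simps)
qed

section \<open>Lower bound for the total weight\<close>

text \<open>An upper Riemann sum with right endpoints: the increments of \<open>arcsin\<close>
  between consecutive centres telescope. The \<open>max 0\<close> clips the first interval, which
  runs from 0 to the first positive centre and has length at most 2/n.\<close>

lemma center_sum_ge_arcsin:
  assumes n: "n > 0" and "center n K < A" "A > 0"
  shows "arcsin (max 0 (center n K) / A) \<le>
    2 / real n * (\<Sum>i | i \<le> K \<and> center n i > 0. 1 / sqrt (A\<^sup>2 - (center n i)\<^sup>2))"
  using assms(2)
proof (induction K)
  case 0
  have "center n 0 \<le> 0" using n by (simp add: center_def divide_le_0_iff)
  then have empty: "{i. i \<le> 0 \<and> center n i > 0} = {}" by auto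
  show ?case unfolding empty using \<open>center n 0 \<le> 0\<close> by simp
next
  case (Suc K)
  have step: "center n (Suc K) = center n K + 2 / real n"
    using center_diff[OF n, of "Suc K" K] by simp
  then have IH: "arcsin (max 0 (center n K) / A) \<le>
      2 / real n * (\<Sum>i | i \<le> K \<and> center n i > 0. 1 / sqrt (A\<^sup>2 - (center n i)\<^sup>2))"
    using Suc n by (smt (verit) divide_pos_pos of_nat_0_less_iff)
  show ?case
  proof (cases "center n (Suc K) > 0")
    case False
    have "center n i \<le> 0" if "i \<le> Suc K" for i
      using that False n by (auto simp: center_def field_simps)
    then have empty: "{i. i \<le> Suc K \<and> center n i > 0} = {}" by (auto simp: not_less[symmetric])
    show ?thesis unfolding empty using False by simp
  next
    case True
    define a where "a = max 0 (center n K)"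
    define b where "b = center n (Suc K)"
    have ab: "0 \<le> a" "a \<le> b" "b < A" "b - a \<le> 2 / real n"
      using True step Suc.prems n by (auto simp: a_def b_def)
    then have "b\<^sup>2 < A\<^sup>2" by (intro power_strict_mono) auto
    have "arcsin (b / A) - arcsin (a / A) \<le> (b - a) / sqrt (A\<^sup>2 - b\<^sup>2)"
      using ab by (intro arcsin_increment)
    also have "\<dots> \<le> (2 / real n) / sqrt (A\<^sup>2 - b\<^sup>2)"
      using ab \<open>b\<^sup>2 < A\<^sup>2\<close> by (intro divide_right_mono) auto
    finally have "arcsin (b / A) \<le> arcsin (a / A) + 2 / real n * (1 / sqrt (A\<^sup>2 - b\<^sup>2))"
      by simp
    moreover have "{i. i \<le> Suc K \<and> center n i > 0} = insert (Suc K) {i. i \<le> K \<and> center n i > 0}"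
      using True by (auto simp: le_Suc_eq)
    moreover have "max 0 (center n (Suc K)) = b" using True by (simp add: b_def)
    ultimately show ?thesis
      using IH unfolding a_def[symmetric] b_def[symmetric]
      by (simp add: distrib_left b_def[symmetric])
  qed
qed

text \<open>The chord of this row has half-length sqrt (1 - c^2), and its last centre lies within
  2/n of the end. Hypothesis \<open>s\<close> then puts that centre beyond the fraction
  \<open>s\<close> of the radius \<open>A\<close>, so each half of the row contributes at least n /
  2 * arcsin s.\<close>

lemma row_weight_ge:
  fixes n j :: nat and e s :: real
  defines "c \<equiv> center n j"
  assumes n: "n > 0" and j: "j \<in> {1..n}" and "e > 0" "0 \<le> s" "s < 1"
    and s: "s * sqrt (1 + 2 * e - c\<^sup>2) \<le> sqrt (1 - c\<^sup>2) - 2 / real n"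
  shows "real n * arcsin s \<le> (\<Sum>i | (j, i) \<in> disc_cells n. weight e n (j, i))"
proof -
  define m where "m = sqrt (1 - c\<^sup>2)"
  define A where "A = sqrt (1 + 2 * e - c\<^sup>2)"
  have "c\<^sup>2 \<le> 1" using abs_center_le[OF j] by (simp add: c_def abs_square_le_1)
  then have m: "0 \<le> m" "m \<le> 1" "m\<^sup>2 = 1 - c\<^sup>2" and A: "A\<^sup>2 = 1 + 2 * e - c\<^sup>2" "0 < A" "m < A"
    using \<open>e > 0\<close> by (auto simp: m_def A_def)
  \<comment> \<open>The largest index with \<open>center n K \<le> m\<close>, from solving (2 K - 1
    - n) / n \<le> m.\<close>
  define K where "K = nat \<lfloor>(real n * m + real n + 1) / 2\<rfloor>"
  define P where "P = {i. i \<le> K \<and> center n i > 0}"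
  define R where "R = {i. (j, i) \<in> disc_cells n}"
  define f where "f i = 1 / sqrt (A\<^sup>2 - (center n i)\<^sup>2)" for i
  have "0 \<le> (real n * m + real n + 1) / 2" using m by simp
  then have K: "real K \<le> (real n * m + real n + 1) / 2" "(real n * m + real n + 1) / 2 < real K + 1"
    unfolding K_def by linarith+
  have cK: "center n K \<le> m" "m - 2 / real n < center n K"
  proof -
    show "center n K \<le> m"
      using K(1) n by (simp add: center_def pos_divide_le_eq mult.commute)
    have "m - 2 / real n = (real n * m - 2) / real n"
      using n by (simp add: diff_divide_distrib)
    also have "\<dots> < center n K"
      unfolding center_def using K(2) n by (intro divide_strict_right_mono) auto
    finally show "m - 2 / real n < center n K" .
  qed
  have "real n * m \<le> real n" using m by (simp add: mult_left_le)
  then have "real K < real (n + 1)" using K(1) by simp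
  then have "K \<le> n" by linarith
  have P: "i \<le> n" "0 < i" "0 < center n i" "(center n i)\<^sup>2 \<le> 1 - c\<^sup>2" if "i \<in> P" for i
  proof -
    show "i \<le> n" "0 < center n i" using that \<open>K \<le> n\<close> by (auto simp: P_def)
    then show "0 < i" by (intro Nat.gr0I) (auto simp: center_def field_simps zero_less_divide_iff)
    have "center n i \<le> center n K" using that n by (auto simp: P_def center_def divide_right_mono)
    then show "(center n i)\<^sup>2 \<le> 1 - c\<^sup>2"
      unfolding m(3)[symmetric] using cK \<open>0 < center n i\<close> by (intro power_mono) auto
  qed
  \<comment> \<open>The reflection of the row in its midpoint. Centres are positive on
    \<open>P\<close> and negative on its image, so the two halves are disjoint; a centre at 0 is
    left out.\<close>
  define g where "g = (\<lambda>i. n + 1 - i)"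
  have g: "center n (g i) = - center n i" if "i \<in> P" for i
    using P[OF that] by (auto simp: g_def center_def of_nat_diff field_simps)
  have "inj_on g P"
  proof (rule inj_onI)
    fix x y assume "x \<in> P" "y \<in> P" "g x = g y"
    then show "x = y" using P(1)[of x] P(1)[of y] unfolding g_def by linarith
  qed
  have finP: "finite P" by (simp add: P_def)
  have finR: "finite R"
    by (rule finite_subset[of _ "{1..n}"]) (auto simp: R_def disc_cells_def)
  have sub: "P \<union> g ` P \<subseteq> R"
    using P g j unfolding R_def disc_cells_def g_def c_def by (fastforce simp: algebra_simps)
  have fnn: "0 \<le> f i" if "i \<in> R" for i
    using that A(1) \<open>e > 0\<close> by (auto simp: f_def R_def disc_cells_def c_def)
  have "arcsin s \<le> arcsin (max 0 (center n K) / A)"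
  proof (rule arcsin_le_arcsin)
    show "s \<le> max 0 (center n K) / A"
      using s cK A by (simp add: pos_le_divide_eq m_def[symmetric] A_def[symmetric])
    show "max 0 (center n K) / A \<le> 1" using cK A by simp
  qed (use \<open>0 \<le> s\<close> in simp)
  also have "\<dots> \<le> 2 / real n * sum f P"
    unfolding f_def P_def using cK A n by (intro center_sum_ge_arcsin) auto
  finally have "real n * arcsin s \<le> sum f P + sum f P"
    using n by (simp add: field_simps)
  also have "\<dots> = sum f P + sum f (g ` P)"
    using g by (simp add: sum.reindex[OF \<open>inj_on g P\<close>] f_def)
  also have "\<dots> = sum f (P \<union> g ` P)"
    using finP g P(3) by (intro sum.union_disjoint[symmetric]) (auto, smt (verit))
  also have "\<dots> \<le> sum f R"
    using sub finR fnn by (intro sum_mono2) auto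
  also have "\<dots> = (\<Sum>i | (j, i) \<in> disc_cells n. weight e n (j, i))"
    by (simp add: R_def f_def weight_def A c_def)
  finally show ?thesis .
qed

text \<open>Near the rim the chords are too short for a uniform estimate, so about \<eta> n rows are
  dropped on each side. Every remaining chord has half-length at least sqrt \<eta>, and one
  \<open>s\<close> serves all of them.\<close>

lemma total_weight_ge:
  assumes n: "n > 0" and "e > 0" "0 \<le> s" "s < 1" "0 < \<eta>" "\<eta> \<le> 1"
    and s: "sqrt (2 * e) + 2 / real n \<le> (1 - s) * sqrt \<eta>"
  shows "(real n - 2 * \<eta> * real n - 2) * (real n * arcsin s) \<le> sum (weight e n) (disc_cells n)"
proof -
  define k where "k = nat \<lceil>\<eta> * real n\<rceil>"
  have k: "\<eta> * real n \<le> real k" "real k < \<eta> * real n + 1"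
    using \<open>0 < \<eta>\<close> by (auto simp: k_def) (smt (verit) ceiling_correct mult_nonneg_nonneg of_nat_0_le_iff)
  define J where "J = {k + 1..n - k}"
  define R where "R j = {i. (j, i) \<in> disc_cells n}" for j
  have as: "0 \<le> arcsin s" using assms by (intro arcsin_nonneg) auto
  have row: "real n * arcsin s \<le> (\<Sum>i\<in>R j. weight e n (j, i))" if "j \<in> J" for j
    unfolding R_def
  proof (rule row_weight_ge)
    show "j \<in> {1..n}" using that by (auto simp: J_def)
    define c where "c = center n j"
    have j: "real k + 1 \<le> real j" "real j + real k \<le> real n" using that by (auto simp: J_def)
    have "\<bar>c\<bar> \<le> 1 - \<eta>" unfolding abs_le_iff c_def center_def
      using j k(1) n by (auto simp: field_simps)
    then have "c\<^sup>2 \<le> (1 - \<eta>)\<^sup>2" by (metis abs_ge_zero power2_abs power_mono)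
    also have "\<dots> \<le> 1 - \<eta>" using assms by (simp add: power2_eq_square mult_left_le)
    finally have m: "\<eta> \<le> 1 - c\<^sup>2" by simp
    have "sqrt (1 + 2 * e - c\<^sup>2) \<le> sqrt (1 - c\<^sup>2) + sqrt (2 * e)"
      using sqrt_add_le_add_sqrt[of "1 - c\<^sup>2" "2 * e"] m assms by (simp add: algebra_simps)
    then have "s * sqrt (1 + 2 * e - c\<^sup>2) \<le> s * (sqrt (1 - c\<^sup>2) + sqrt (2 * e))"
      using assms by (intro mult_left_mono)
    also have "\<dots> \<le> s * sqrt (1 - c\<^sup>2) + sqrt (2 * e)"
      using assms by (simp add: distrib_left mult_left_le_one_le)
    also have "\<dots> \<le> sqrt (1 - c\<^sup>2) - 2 / real n"
    proof -
      have "(1 - s) * sqrt \<eta> \<le> (1 - s) * sqrt (1 - c\<^sup>2)"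
        using m assms by (intro mult_left_mono) auto
      then show ?thesis using s by (simp add: algebra_simps)
    qed
    finally show "s * sqrt (1 + 2 * e - (center n j)\<^sup>2) \<le> sqrt (1 - (center n j)\<^sup>2) - 2 / real n"
      unfolding c_def .
  qed (use assms in auto)
  \<comment> \<open>At most \<eta> n + 1 rows are lost on each side; if these exhaust the board,
    \<open>J\<close> is empty and the left side is negative.\<close>
  have "real n - 2 * \<eta> * real n - 2 \<le> real (card J)"
    using k(2) unfolding J_def by auto
  then have "(real n - 2 * \<eta> * real n - 2) * (real n * arcsin s) \<le> real (card J) * (real n * arcsin s)"
    using as by (intro mult_right_mono) auto
  also have "\<dots> = (\<Sum>j\<in>J. real n * arcsin s)" by simp
  also have "\<dots> \<le> (\<Sum>j\<in>J. \<Sum>i\<in>R j. weight e n (j, i))"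
    using row by (rule sum_mono)
  also have "\<dots> = sum (weight e n) (Sigma J R)"
    by (subst sum.Sigma) (auto simp: J_def R_def disc_cells_def split_def
        intro: finite_subset[of _ "{1..n}"])
  also have "\<dots> \<le> sum (weight e n) (disc_cells n)"
    using finite_disc_cells \<open>e > 0\<close>
    by (intro sum_mono2) (auto simp: R_def, auto simp: weight_def disc_cells_def)
  finally show ?thesis .
qed

section \<open>Double counting and the choice of constants\<close>

text \<open>Each disc cell is pierced at least once, so its weight is at most its weight summed over
  the lines through it. Exchanging the sums leaves \<open>line_weight_le\<close> for each
  line.\<close>

lemma total_weight_le:
  assumes "pierces_board n F" "finite F" and n: "n > 0" "12 / real n \<le> e" "e > 0"
  shows "sum (weight e n) (disc_cells n) \<le>
    real (card F) * (real n / 2 * (sqrt 2 * pi) + 4 / sqrt e)"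
proof -
  define hit where "hit x L \<longleftrightarrow> pierces L (cell n (fst x) (snd x))" for x L
  have "weight e n x \<le> (\<Sum>L | L \<in> F \<and> hit x L. weight e n x)" if x: "x \<in> disc_cells n" for x
  proof -
    have "{L \<in> F. hit x L} \<noteq> {}"
      using assms(1) x unfolding pierces_board_def hit_def disc_cells_def by fastforce
    then have "1 \<le> real (card {L \<in> F. hit x L})"
      using \<open>finite F\<close> by (simp add: Suc_le_eq card_gt_0_iff)
    moreover have "0 \<le> weight e n x"
      using x \<open>e > 0\<close> by (auto simp: weight_def disc_cells_def)
    ultimately show ?thesis by (simp add: mult_le_cancel_right1)
  qed
  then have "sum (weight e n) (disc_cells n) \<le>
      (\<Sum>x\<in>disc_cells n. \<Sum>L | L \<in> F \<and> hit x L. weight e n x)"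
    by (rule sum_mono)
  also have "\<dots> = (\<Sum>L\<in>F. \<Sum>x | x \<in> disc_cells n \<and> hit x L. weight e n x)"
    by (rule sum.swap_restrict[OF finite_disc_cells \<open>finite F\<close>])
  also have "\<dots> = (\<Sum>L\<in>F. sum (weight e n) {(i, j) \<in> disc_cells n. pierces L (cell n i j)})"
  proof -
    have "{x. x \<in> disc_cells n \<and> hit x L} = {(i, j) \<in> disc_cells n. pierces L (cell n i j)}" for L
      by (auto simp: hit_def)
    then show ?thesis by simp
  qed
  also have "\<dots> \<le> (\<Sum>L\<in>F. real n / 2 * (sqrt 2 * pi) + 4 / sqrt e)"
    using assms(1) n by (intro sum_mono line_weight_le) (auto simp: pierces_board_def)
  finally show ?thesis by simp
qed

theorem theorem3:
  shows "\<forall>\<^sub>F n in sequentially. real (piercing_number n) > 0.7 * real n"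
proof -
  define s where "s = sin (0.999 * (pi / 2))"
  define \<eta> where "\<eta> = (0.001 :: real)"
  have as: "arcsin s = 0.999 * (pi / 2)"
    unfolding s_def by (rule arcsin_sin) auto
  have s0: "0 \<le> s" unfolding s_def by (rule sin_ge_zero) auto
  have "s < sin (pi / 2)" unfolding s_def by (rule sin_monotone_2pi) auto
  then have s1: "s < 1" by simp
  \<comment> \<open>Half of the slack (1 - s) sqrt \<eta> in \<open>total_weight_ge\<close>: one
    half pays for sqrt (2 e), the other for 2/n.\<close>
  define q where "q = (1 - s) * sqrt \<eta> / 2"
  have q: "q > 0" using s1 by (simp add: q_def \<eta>_def)
  define e where "e = q\<^sup>2 / 2"
  have e: "e > 0" "sqrt (2 * e) = q" using q by (auto simp: e_def)
  \<comment> \<open>The gap between the n^2 coefficients of the two estimates if only 0.7 n lines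
    are used. It is positive because 0.998 * 0.999 > 0.997, while 0.7 * 1.415 < 0.991.\<close>
  define \<delta> where "\<delta> = pi / 2 * (0.998 * 0.999 - 0.7 * sqrt 2)"
  have "sqrt 2 \<le> 1.415" by (rule real_le_lsqrt) (auto simp: power2_eq_square)
  then have \<delta>: "\<delta> > 0" by (simp add: \<delta>_def)
  have ev: "\<forall>\<^sub>F n in sequentially. c < real n" for c
    using filterlim_real_sequentially by (simp add: filterlim_at_top_dense)
  show ?thesis
    \<comment> \<open>The first two thresholds make n admissible for the weight estimates; beyond
      the third, \<delta> n exceeds all lower-order terms.\<close>
    using ev[of "12 / e"] ev[of "2 / q"] ev[of "(0.7 * (4 / sqrt e) + 0.999 * pi) / \<delta>"]
      eventually_gt_at_top[of 0]
  proof eventually_elim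
    case (elim n)
    have n: "12 / real n \<le> e" "2 / real n \<le> q" "n > 0"
      using elim e q by (auto simp: field_simps)
    obtain F where F: "finite F" "card F = piercing_number n" "pierces_board n F"
      using piercing_number_attained by blast
    have "(real n - 2 * \<eta> * real n - 2) * (real n * arcsin s) \<le> sum (weight e n) (disc_cells n)"
      by (rule total_weight_ge) (use n e s0 s1 in \<open>auto simp: \<eta>_def q_def\<close>)
    also have "\<dots> \<le> real (piercing_number n) * (real n / 2 * (sqrt 2 * pi) + 4 / sqrt e)"
      using total_weight_le[OF F(3,1) n(3,1) e(1)] F(2) by simp
    finally have le: "(real n - 2 * \<eta> * real n - 2) * (real n * arcsin s) \<le>
        real (piercing_number n) * (real n / 2 * (sqrt 2 * pi) + 4 / sqrt e)" .
    show ?case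
    proof (rule ccontr)
      assume "\<not> real (piercing_number n) > 0.7 * real n"
      then have "real (piercing_number n) * (real n / 2 * (sqrt 2 * pi) + 4 / sqrt e) \<le>
          0.7 * real n * (real n / 2 * (sqrt 2 * pi) + 4 / sqrt e)"
        using e by (intro mult_right_mono) auto
      with le have "(real n - 2 * \<eta> * real n - 2) * (real n * arcsin s) \<le>
          0.7 * real n * (real n / 2 * (sqrt 2 * pi) + 4 / sqrt e)"
        by linarith
      then have "real n * ((0.998 * real n - 2) * (0.999 * (pi / 2))) \<le>
          real n * (0.7 * (real n / 2 * (sqrt 2 * pi) + 4 / sqrt e))"
        unfolding as \<eta>_def by (simp add: algebra_simps)
      then have "(0.998 * real n - 2) * (0.999 * (pi / 2)) \<le>
          0.7 * (real n / 2 * (sqrt 2 * pi) + 4 / sqrt e)"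
        using n(3) by simp
      then have "\<delta> * real n \<le> 0.7 * (4 / sqrt e) + 0.999 * pi"
        by (simp add: \<delta>_def algebra_simps)
      then show False using elim(3) \<delta> by (simp add: field_simps)
    qed
  qed
qed

end
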